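(* Let $x_0$ be the larger root of the equation $14x^2-14x+3=0$ (so $x_0=0.68898\ldots$). Then $$\gamma_{b,c}\ \ge\ \frac{2-2x_0}{3}.$$ Consequently, $\gamma_{b,c}\ge 0.207$ and $\gamma_{b\leftrightarrow c}\ge 0.1035$.
   Context: All graphs are finite and simple. $|T|$ is the number of vertices of a tree $T$; $\mathcal T_k$ is the set of all trees on at least $k$ vertices. A graph is $T$-free if it has no (not necessarily induced) subgraph isomorphic to $T$. $\mathrm{ex}_b(n,T)$ (resp. $\mathrm{ex}_{b,c}(n,T)$) is the largest number of edges of a $T$-free bipartite graph (resp. $T$-free connected bipartite graph) with both parts of size $n$; for trees $T$ with at least $5$ vertices, $\mathrm{ex}_{b,c}(n,T)$ is defined for all $n$. For a tree $T$ define $$\gamma_{b,c,T}=\limsup_{n\to\infty}\frac{\mathrm{ex}_{b,c}(n,T)}{(|T|-2)\,n},\qquad \gamma_{b\leftrightarrow c,T}=\limsup_{n\to\infty}\frac{\mathrm{ex}_{b,c}(n,T)}{\mathrm{ex}_b(n,T)},$$ and $$\gamma_{b,c}=\lim_{k\to\infty}\inf\{\gamma_{b,c,T}:T\in\mathcal T_k\},\qquad \gamma_{b\leftrightarrow c}=\lim_{k\to\infty}\inf\{\gamma_{b\leftrightarrow c,T}:T\in\mathcal T_k\}$$ (with $k\ge 5$). *)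

theory Defs
  imports "HOL-Analysis.Analysis"
begin

record 'a ugraph =
  verts :: "'a set"
  edges :: "'a set set"

definition simple_graph :: "'a ugraph \<Rightarrow> bool" where
  "simple_graph G \<longleftrightarrow> finite (verts G) \<and> (\<forall>e\<in>edges G. e \<subseteq> verts G \<and> card e = 2)"

definition adj :: "'a ugraph \<Rightarrow> ('a \<times> 'a) set" where
  "adj G = {(u, v). {u, v} \<in> edges G}"

text \<open>The graph without vertices does not count as connected.\<close>

definition graph_connected :: "'a ugraph \<Rightarrow> bool" where
  "graph_connected G \<longleftrightarrow>
     verts G \<noteq> {} \<and> (\<forall>u\<in>verts G. \<forall>v\<in>verts G. (u, v) \<in> (adj G)\<^sup>*)"

definition is_cycle :: "'a ugraph \<Rightarrow> 'a list \<Rightarrow> bool" where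
  "is_cycle G p \<longleftrightarrow>
     length p \<ge> 3 \<and> distinct p \<and>
     (\<forall>i. Suc i < length p \<longrightarrow> {p ! i, p ! Suc i} \<in> edges G) \<and>
     {last p, hd p} \<in> edges G"

definition is_tree :: "'a ugraph \<Rightarrow> bool" where
  "is_tree T \<longleftrightarrow> simple_graph T \<and> graph_connected T \<and> (\<nexists>p. is_cycle T p)"

definition is_subgraph :: "'a ugraph \<Rightarrow> 'a ugraph \<Rightarrow> bool" where
  "is_subgraph H G \<longleftrightarrow> simple_graph H \<and> verts H \<subseteq> verts G \<and> edges H \<subseteq> edges G"

definition isomorphic :: "'a ugraph \<Rightarrow> 'b ugraph \<Rightarrow> bool" where
  "isomorphic G H \<longleftrightarrow>
     (\<exists>f. bij_betw f (verts G) (verts H) \<and>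
          (\<forall>u\<in>verts G. \<forall>v\<in>verts G. {u, v} \<in> edges G \<longleftrightarrow> {f u, f v} \<in> edges H))"

definition graph_free :: "'b ugraph \<Rightarrow> 'a ugraph \<Rightarrow> bool" where
  "graph_free T G \<longleftrightarrow> (\<nexists>H. is_subgraph H G \<and> isomorphic H T)"

definition balanced_bipartite :: "nat \<Rightarrow> 'a ugraph \<Rightarrow> bool" where
  "balanced_bipartite n G \<longleftrightarrow> simple_graph G \<and>
     (\<exists>A B. A \<inter> B = {} \<and> A \<union> B = verts G \<and> card A = n \<and> card B = n \<and>
            (\<forall>e\<in>edges G. \<exists>a\<in>A. \<exists>b\<in>B. e = {a, b}))"

text \<open>
  Every finite graph has a copy with vertices in \<^typ>\<open>nat\<close>, so graphs with vertices in
  \<^typ>\<open>nat\<close> suffice both for the graphs \<open>G\<close> below and for the trees \<open>T\<close>.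
  The sets below are finite.  The set in \<open>ex_bc\<close> is nonempty for \<open>n \<ge> 1\<close> if \<open>T\<close> is a tree with
  at least \<open>5\<close> vertices (take a Hamiltonian path if \<open>T\<close> is not a path, and a spanning double
  star otherwise); for \<open>n = 0\<close> it is empty, which does not affect the upper limits.
\<close>

definition ex_b :: "nat \<Rightarrow> nat ugraph \<Rightarrow> nat" where
  "ex_b n T = Max {card (edges G) |G :: nat ugraph. balanced_bipartite n G \<and> graph_free T G}"

definition ex_bc :: "nat \<Rightarrow> nat ugraph \<Rightarrow> nat" where
  "ex_bc n T =
     Max {card (edges G) |G :: nat ugraph.
            balanced_bipartite n G \<and> graph_connected G \<and> graph_free T G}"

lemma finite_balanced_bipartite_sizes:
  "finite {card (edges G) |G :: nat ugraph. balanced_bipartite n G \<and> P G}"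
proof (rule finite_subset)
  show "{card (edges G) |G :: nat ugraph. balanced_bipartite n G \<and> P G} \<subseteq> {..n * n}"
  proof
    fix m
    assume "m \<in> {card (edges G) |G :: nat ugraph. balanced_bipartite n G \<and> P G}"
    then obtain G :: "nat ugraph" where m: "m = card (edges G)" and "balanced_bipartite n G"
      by blast
    then obtain A B where *: "simple_graph G" "A \<union> B = verts G" "card A = n" "card B = n"
      "\<forall>e\<in>edges G. \<exists>a\<in>A. \<exists>b\<in>B. e = {a, b}"
      unfolding balanced_bipartite_def by blast
    have fin: "finite A" "finite B"
      using * finite_Un[of A B] unfolding simple_graph_def by simp_all
    have "edges G \<subseteq> (\<lambda>(a, b). {a, b}) ` (A \<times> B)"
      using *(5) by fastforce
    then have "card (edges G) \<le> card (A \<times> B)"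
      using fin by (meson card_image_le card_mono finite_SigmaI finite_imageI le_trans)
    then show "m \<in> {..n * n}"
      using * m by (simp add: card_cartesian_product)
  qed
qed simp

definition trees_ge :: "nat \<Rightarrow> nat ugraph set" where
  "trees_ge k = {T. is_tree T \<and> card (verts T) \<ge> k}"

definition gamma_bc_tree :: "nat ugraph \<Rightarrow> ereal" where
  "gamma_bc_tree T =
     limsup (\<lambda>n. ereal (real (ex_bc n T) / ((real (card (verts T)) - 2) * real n)))"

definition gamma_b_to_bc_tree :: "nat ugraph \<Rightarrow> ereal" where
  "gamma_b_to_bc_tree T = limsup (\<lambda>n. ereal (real (ex_bc n T) / real (ex_b n T)))"

definition gamma_bc :: ereal where
  "gamma_bc = lim (\<lambda>k. INF T\<in>trees_ge k. gamma_bc_tree T)"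

definition gamma_b_to_bc :: ereal where
  "gamma_b_to_bc = lim (\<lambda>k. INF T\<in>trees_ge k. gamma_b_to_bc_tree T)"

lemma convergent_INF_trees_ge:
  fixes f :: "nat ugraph \<Rightarrow> ereal"
  shows "convergent (\<lambda>k. INF T\<in>trees_ge k. f T)"
proof -
  have "incseq (\<lambda>k. INF T\<in>trees_ge k. f T)"
    by (auto intro!: monoI INF_superset_mono simp: trees_ge_def)
  then show ?thesis
    unfolding convergent_def using LIMSEQ_SUP by blast
qed

end

theory Submission
  imports Defs
begin

text \<open>
  Let \<open>T\<close> have \<open>k\<close> vertices.  If no \<open>t\<close> vertices cover all edges of \<open>T\<close>, then \<open>T\<close> is not contained in a
  graph that has a vertex cover of size \<open>t\<close>, such as the double star, which has about \<open>t * n\<close>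
  edges.  If \<open>t\<close> vertices do cover all edges of \<open>T\<close>, then a copy of \<open>T\<close> cannot have many edges in a
  graph of maximum degree 2.  Attach complete bipartite blocks \<open>K\<^sub>s\<^sub>,\<^sub>s\<close> to a sparse spine by paths of length
  more than \<open>t\<close>.  A copy of \<open>T\<close> that meets two blocks contains both of their paths, which \<open>t\<close> vertices
  cannot cover.  So it meets at most one block, has fewer than \<open>2 * s\<close> edges there and little more than
  \<open>2 * t\<close> edges elsewhere, which is too few if \<open>2 * s + 2 * t\<close> is slightly less than \<open>k\<close>.

  For the comparison with the number \<open>ex_b\<close>, a graph with \<open>N\<close> vertices and more than \<open>(k - 2) * N\<close> edges has
  a subgraph of minimum degree at least \<open>k - 1\<close>, and this contains \<open>T\<close>.
\<close>

section \<open>Graphs and trees\<close>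

lemma simple_graph_finite_edges: "simple_graph G \<Longrightarrow> finite (edges G)"
  unfolding simple_graph_def by (metis PowI finite_Pow_iff finite_subset subsetI)

lemma is_cycle_mono:
  assumes "edges H \<subseteq> edges G" "is_cycle H p"
  shows "is_cycle G p"
  using assms unfolding is_cycle_def by blast

text \<open>\<open>W\<close> may be any set, not only a set of vertices: \<open>- {v}\<close>
  deletes a vertex, and a condition on residues will select the block vertices of a comb.\<close>

definition induced :: "'a ugraph \<Rightarrow> 'a set \<Rightarrow> 'a ugraph" where
  "induced G W = \<lparr>verts = verts G \<inter> W, edges = {e \<in> edges G. e \<subseteq> W}\<rparr>"

lemma verts_induced [simp]: "verts (induced G W) = verts G \<inter> W"
  and edges_induced [simp]: "edges (induced G W) = {e \<in> edges G. e \<subseteq> W}"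
  by (simp_all add: induced_def)

lemma simple_graph_induced: "simple_graph G \<Longrightarrow> simple_graph (induced G W)"
  by (auto simp: simple_graph_def)

lemma is_cycle_induced: "is_cycle (induced G W) p \<Longrightarrow> is_cycle G p"
  by (rule is_cycle_mono[of "induced G W"]) auto

lemma simple_edgeE:
  assumes "simple_graph G" "e \<in> edges G" "v \<in> e"
  obtains u where "e = {v, u}" "u \<noteq> v" "u \<in> verts G" "v \<in> verts G"
proof -
  have "card e = 2" "e \<subseteq> verts G"
    using assms by (auto simp: simple_graph_def)
  then obtain a b where "e = {a, b}" "a \<noteq> b"
    by (auto simp: card_2_iff)
  then show ?thesis
    using that assms(3) \<open>e \<subseteq> verts G\<close> by (metis insert_commute insert_iff insert_subset singletonD)
qed

text \<open>The end of a longest path is a leaf: another neighbour would extend the path or close a cycle.\<close>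

lemma exists_leaf:
  assumes G: "simple_graph G" "\<nexists>p. is_cycle G p" and "edges G \<noteq> {}"
  obtains v u where "{v, u} \<in> edges G" "u \<noteq> v" "\<And>e. e \<in> edges G \<Longrightarrow> v \<in> e \<Longrightarrow> e = {v, u}"
proof -
  define pth where "pth = (\<lambda>p. length p \<ge> 2 \<and> distinct p \<and> set p \<subseteq> verts G \<and>
     (\<forall>i. Suc i < length p \<longrightarrow> {p ! i, p ! Suc i} \<in> edges G))"
  obtain e where "e \<in> edges G" using assms(3) by blast
  moreover from this obtain v0 where "v0 \<in> e"
    using G(1) unfolding simple_graph_def by fastforce
  ultimately obtain u0 where "{v0, u0} \<in> edges G" "u0 \<noteq> v0" "u0 \<in> verts G" "v0 \<in> verts G"
    using simple_edgeE[OF G(1)] by metis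
  then have ex: "pth [v0, u0]"
    by (auto simp: pth_def less_Suc_eq)
  have bound: "length p < Suc (card (verts G))" if "pth p" for p
    using that G(1) unfolding pth_def simple_graph_def
    by (metis card_mono distinct_card less_Suc_eq_le)
  obtain p where p: "pth p" and longest: "\<And>q. pth q \<Longrightarrow> length q \<le> length p"
    using ex_has_greatest_nat[of pth "[v0, u0]" length "Suc (card (verts G))"] ex bound
    by (meson less_imp_le)
  have len: "2 \<le> length p" and dist: "distinct p" and inV: "set p \<subseteq> verts G"
    and E: "\<And>i. Suc i < length p \<Longrightarrow> {p ! i, p ! Suc i} \<in> edges G"
    using p by (auto simp: pth_def)
  have 1: "{p ! 0, p ! 1} \<in> edges G" using E[of 0] len by simp
  show ?thesis
  proof
    show "{p ! 0, p ! 1} \<in> edges G" by fact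
    show "p ! 1 \<noteq> p ! 0" using dist len nth_eq_iff_index_eq[of p 1 0] by fastforce
    fix e assume e: "e \<in> edges G" "p ! 0 \<in> e"
    then obtain w where w: "e = {p ! 0, w}" "w \<noteq> p ! 0" "w \<in> verts G"
      using simple_edgeE[OF G(1)] by metis
    have "w \<in> set p"
    proof (rule ccontr)
      assume "w \<notin> set p"
      then have "pth (w # p)"
        using dist inV w E e len unfolding pth_def
        by (auto simp: nth_Cons insert_commute split: nat.splits)
      then show False using longest by fastforce
    qed
    then obtain j where j: "j < length p" "p ! j = w" by (auto simp: in_set_conv_nth)
    show "e = {p ! 0, p ! 1}"
    proof (rule ccontr)
      assume "e \<noteq> {p ! 0, p ! 1}"
      \<comment> \<open>Since \<open>w\<close> is neither of the first two vertices, the prefix of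
        \<open>p\<close> that ends in \<open>w\<close> has at least three vertices, and
        \<open>e\<close> closes it to a cycle.\<close>
      then have "j \<noteq> 0" "j \<noteq> 1" using w j by auto
      moreover have "last (take (Suc j) p) = w" "hd (take (Suc j) p) = p ! 0"
        using j by (auto simp: take_Suc_conv_app_nth hd_conv_nth nth_append)
      ultimately have "is_cycle G (take (Suc j) p)"
        using j dist E e w len unfolding is_cycle_def by (auto simp: insert_commute min_def)
      then show False using G(2) by blast
    qed
  qed
qed

text \<open>Deleting a leaf removes one vertex and one edge. The exact count is smaller by the
  number of components; this coarser form costs only a constant in the comb.\<close>

lemma forest_card_edges:
  assumes "simple_graph G" "\<nexists>p. is_cycle G p"
  shows "card (edges G) \<le> card (verts G)"
  using assms
proof (induction "card (verts G)" arbitrary: G rule: less_induct)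
  case less
  show ?case
  proof (cases "edges G = {}")
    case False
    obtain v u where uv: "{v, u} \<in> edges G" "u \<noteq> v"
      and leaf: "\<And>e. e \<in> edges G \<Longrightarrow> v \<in> e \<Longrightarrow> e = {v, u}"
      by (rule exists_leaf[OF less.prems False]) blast
    let ?H = "induced G (- {v})"
    have v: "v \<in> verts G" and fin: "finite (verts G)"
      using uv less.prems(1) by (auto simp: simple_graph_def)
    have V: "verts ?H = verts G - {v}" by auto
    have IH: "card (edges ?H) \<le> card (verts ?H)"
      using less.hyps[of ?H] less.prems card_Diff1_less[OF fin v] V
        simple_graph_induced is_cycle_induced by metis
    have cV: "card (verts G) = Suc (card (verts ?H))"
      using V v fin by (metis card.remove)
    have "edges G \<subseteq> insert {v, u} (edges ?H)"
      using leaf by auto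
    moreover have "finite (edges ?H)"
      using less.prems(1) simple_graph_finite_edges simple_graph_induced by blast
    ultimately have "card (edges G) \<le> card (insert {v, u} (edges ?H))"
      by (intro card_mono) auto
    also have "\<dots> \<le> Suc (card (edges ?H))"
      using \<open>finite (edges ?H)\<close> by (simp add: card_insert_if)
    finally have "card (edges G) \<le> Suc (card (edges ?H))" .
    with IH cV show ?thesis by linarith
  qed simp
qed

text \<open>A walk from \<open>x\<close> to \<open>y\<close> has to leave \<open>X\<close>
  somewhere. If a host graph has only one edge leaving \<open>X\<close>, a connected subgraph with
  vertices on both sides must therefore contain that edge.\<close>

lemma connected_crossing_edge:
  assumes "graph_connected G" "x \<in> verts G" "x \<in> X" "y \<in> verts G" "y \<notin> X"
  obtains u v where "{u, v} \<in> edges G" "u \<in> X" "v \<notin> X"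
proof -
  have "(x, y) \<in> (adj G)\<^sup>*"
    using assms by (auto simp: graph_connected_def)
  then have "\<exists>u v. {u, v} \<in> edges G \<and> u \<in> X \<and> v \<notin> X"
    using assms(3,5) by (induction rule: converse_rtrancl_induct) (auto simp: adj_def)
  then show ?thesis using that by blast
qed

lemma connected_card_edges:
  assumes G: "simple_graph G" "graph_connected G"
  shows "card (verts G) \<le> Suc (card (edges G))"
proof -
  have fin: "finite (verts G)" using G by (simp add: simple_graph_def)
  obtain r where r: "r \<in> verts G" using G(2) by (auto simp: graph_connected_def)
  \<comment> \<open>Grow \<open>S\<close> one vertex at a time. Each crossing edge brings a new
    vertex together with an edge that was not inside \<open>S\<close> before.\<close>
  have grow: "\<exists>S\<subseteq>verts G. card S = Suc m \<and> m \<le> card {e \<in> edges G. e \<subseteq> S}"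
    if "m < card (verts G)" for m
    using that
  proof (induction m)
    case 0
    then show ?case using r by (intro exI[of _ "{r}"]) auto
  next
    case (Suc m)
    then obtain S where S: "S \<subseteq> verts G" "card S = Suc m" "m \<le> card {e \<in> edges G. e \<subseteq> S}"
      by auto
    have finS: "finite S" using S(1) fin finite_subset by blast
    obtain x where x: "x \<in> S" using S(2) by fastforce
    obtain y where y: "y \<in> verts G" "y \<notin> S"
      using Suc.prems S by (metis nat_neq_iff subsetI subset_antisym)
    obtain u v where uv: "{u, v} \<in> edges G" "u \<in> S" "v \<notin> S"
      using connected_crossing_edge[OF G(2) _ x y] x S(1) by blast
    have "v \<in> verts G" using uv(1) G(1) by (auto simp: simple_graph_def)
    moreover have "insert {u, v} {e \<in> edges G. e \<subseteq> S} \<subseteq> {e \<in> edges G. e \<subseteq> insert v S}"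
      using uv by auto
    then have "card (insert {u, v} {e \<in> edges G. e \<subseteq> S}) \<le> card {e \<in> edges G. e \<subseteq> insert v S}"
      by (intro card_mono) (auto simp: simple_graph_finite_edges[OF G(1)])
    then have "Suc m \<le> card {e \<in> edges G. e \<subseteq> insert v S}"
      using S(3) uv(3) by (simp add: simple_graph_finite_edges[OF G(1)])
    ultimately show ?case
      using S finS uv(3) by (intro exI[of _ "insert v S"]) auto
  qed
  have "0 < card (verts G)" using r fin by (auto simp: card_gt_0_iff)
  then have "card (verts G) - 1 < card (verts G)" by simp
  from grow[OF this] obtain S where "card (verts G) - 1 \<le> card {e \<in> edges G. e \<subseteq> S}"
    by blast
  also have "\<dots> \<le> card (edges G)"
    by (intro card_mono) (auto simp: simple_graph_finite_edges[OF G(1)])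
  finally show ?thesis by linarith
qed

text \<open>Copies of \<open>T\<close> are analysed inside the host, so they have to be trees
  themselves. Walks are pulled back along the inverse of \<open>f\<close>, while a cycle of
  \<open>H\<close> would be carried by \<open>f\<close> to a cycle of \<open>T\<close>.\<close>

lemma isomorphic_tree:
  fixes H :: "'a ugraph" and T :: "'b ugraph"
  assumes H: "simple_graph H" and f: "bij_betw f (verts H) (verts T)"
    and iso: "\<forall>u\<in>verts H. \<forall>v\<in>verts H. {u, v} \<in> edges H \<longleftrightarrow> {f u, f v} \<in> edges T"
    and T: "is_tree T"
  shows "is_tree H"
proof -
  have sT: "simple_graph T" using T by (simp add: is_tree_def)
  let ?g = "inv_into (verts H) f"
  have g: "?g x \<in> verts H" "f (?g x) = x" if "x \<in> verts T" for x
    using that f by (metis bij_betw_def inv_into_into f_inv_into_f)+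
  have gf: "?g (f x) = x" if "x \<in> verts H" for x
    using that f by (simp add: bij_betw_def)
  have step: "(?g x, ?g y) \<in> adj H" if "(x, y) \<in> adj T" for x y
  proof -
    have "x \<in> verts T" "y \<in> verts T"
      using that sT by (auto simp: adj_def simple_graph_def)
    then show ?thesis using that g iso by (auto simp: adj_def)
  qed
  have "(?g x, ?g y) \<in> (adj H)\<^sup>*" if "(x, y) \<in> (adj T)\<^sup>*" for x y
    using that by (induction rule: rtrancl_induct) (auto intro: step rtrancl_into_rtrancl)
  moreover have "f u \<in> verts T" if "u \<in> verts H" for u
    using f that by (auto simp: bij_betw_def)
  ultimately have "(u, v) \<in> (adj H)\<^sup>*" if "u \<in> verts H" "v \<in> verts H" for u v
    using that T gf by (metis graph_connected_def is_tree_def)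
  moreover have "verts H \<noteq> {}"
    using f T by (auto simp: bij_betw_def is_tree_def graph_connected_def)
  ultimately have "graph_connected H" by (simp add: graph_connected_def)
  moreover have False if p: "is_cycle H p" for p
  proof -
    have len: "length p \<ge> 3" using p by (simp add: is_cycle_def)
    have inV: "p ! i \<in> verts H" if "i < length p" for i
    proof (cases "Suc i < length p")
      case True
      then have "{p ! i, p ! Suc i} \<in> edges H" using p by (auto simp: is_cycle_def)
      then show ?thesis using H by (auto simp: simple_graph_def)
    next
      case False
      then have "p ! i = last p" using that len
        by (metis One_nat_def Suc_lessI diff_Suc_1 last_conv_nth list.size(3) not_less_zero)
      moreover have "{last p, hd p} \<in> edges H" using p by (auto simp: is_cycle_def)
      ultimately show ?thesis using H by (auto simp: simple_graph_def)
    qed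
    then have sub: "set p \<subseteq> verts H" by (auto simp: in_set_conv_nth)
    then have "inj_on f (set p)" using f by (meson bij_betw_def inj_on_subset)
    moreover have "last p \<in> verts H" "hd p \<in> verts H"
      using sub len last_in_set[of p] list.set_sel(1)[of p] by fastforce+
    ultimately have "is_cycle T (map f p)"
      using p inV iso len unfolding is_cycle_def
      by (cases "p = []") (auto simp: distinct_map last_map hd_map)
    then show False using T by (auto simp: is_tree_def)
  qed
  ultimately show ?thesis using H by (auto simp: is_tree_def)
qed

section \<open>The edge bound for bipartite graphs without a given tree\<close>

text \<open>Deleting a vertex of degree at most \<open>d\<close> preserves the strict inequality
  between edges and \<open>d\<close> times vertices. The deletions cannot exhaust the graph, because
  the inequality fails when no vertices are left.\<close>

lemma min_degree_subgraph:
  assumes "simple_graph G" "d * card (verts G) < card (edges G)"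
  shows "\<exists>W\<subseteq>verts G. W \<noteq> {} \<and> (\<forall>w\<in>W. d < card {e \<in> edges G. e \<subseteq> W \<and> w \<in> e})"
  using assms
proof (induction "card (verts G)" arbitrary: G rule: less_induct)
  case less
  have fin: "finite (verts G)" "finite (edges G)"
    using less.prems simple_graph_finite_edges by (auto simp: simple_graph_def)
  show ?case
  proof (cases "\<forall>w\<in>verts G. d < card {e \<in> edges G. e \<subseteq> verts G \<and> w \<in> e}")
    case True
    moreover have "verts G \<noteq> {}"
    proof
      assume "verts G = {}"
      then have "edges G \<subseteq> {{}}" using less.prems(1) by (auto simp: simple_graph_def)
      moreover have "{} \<notin> edges G" using less.prems(1) by (auto simp: simple_graph_def)
      ultimately have "edges G = {}" by blast
      then show False using less.prems(2) by simp
    qed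
    ultimately show ?thesis by blast
  next
    case False
    then obtain v where v: "v \<in> verts G" "card {e \<in> edges G. e \<subseteq> verts G \<and> v \<in> e} \<le> d"
      by force
    have deg: "card {e \<in> edges G. v \<in> e} \<le> d"
      using v(2) less.prems(1) by (smt (verit) Collect_cong simple_graph_def)
    let ?H = "induced G (- {v})"
    have V: "verts ?H = verts G - {v}" by auto
    have cV: "card (verts G) = Suc (card (verts ?H))"
      using V v fin by (metis card.remove)
    have "edges G = edges ?H \<union> {e \<in> edges G. v \<in> e}" by auto
    then have "card (edges G) \<le> card (edges ?H) + card {e \<in> edges G. v \<in> e}"
      using card_Un_le by metis
    also have "\<dots> \<le> card (edges ?H) + d" using deg by simp
    finally have "card (edges G) \<le> card (edges ?H) + d" .
    then have "d * card (verts ?H) < card (edges ?H)"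
      using less.prems(2) cV by simp
    then obtain W where W: "W \<subseteq> verts ?H" "W \<noteq> {}"
      "\<forall>w\<in>W. d < card {e \<in> edges ?H. e \<subseteq> W \<and> w \<in> e}"
      using less.hyps[of ?H, OF _ simple_graph_induced[OF less.prems(1)]] cV by auto
    have "{e \<in> edges ?H. e \<subseteq> W \<and> w \<in> e} = {e \<in> edges G. e \<subseteq> W \<and> w \<in> e}" for w
      using W(1) by auto
    then show ?thesis using W V by (intro exI[of _ W]) auto
  qed
qed

text \<open>Greedy embedding: embed the forest without a leaf \<open>v\<close>, then send
  \<open>v\<close> to a neighbour of the image of \<open>u\<close> that is still free. The degree
  bound guarantees such a neighbour.\<close>

lemma forest_embeds:
  fixes T :: "'a ugraph" and G :: "'b ugraph"
  assumes "simple_graph T" "\<nexists>p. is_cycle T p" "card (verts T) \<le> Suc d"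
    and G: "simple_graph G" "verts G \<noteq> {}" "\<And>w. w \<in> verts G \<Longrightarrow> d \<le> card {e \<in> edges G. w \<in> e}"
  shows "\<exists>f. inj_on f (verts T) \<and> f ` verts T \<subseteq> verts G \<and> (\<forall>e\<in>edges T. f ` e \<in> edges G)"
  using assms(1-3)
proof (induction "card (verts T)" arbitrary: T rule: less_induct)
  case less
  have fin: "finite (verts T)" and finG: "finite (verts G)"
    using less.prems G(1) by (auto simp: simple_graph_def)
  have star: "card {e \<in> edges G. w \<in> e \<and> e \<subseteq> S} \<le> card (S - {w})" if "finite S" for w S
  proof -
    have "{e \<in> edges G. w \<in> e \<and> e \<subseteq> S} \<subseteq> (\<lambda>u. {w, u}) ` (S - {w})"
    proof
      fix e assume e: "e \<in> {e \<in> edges G. w \<in> e \<and> e \<subseteq> S}"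
      then have "e \<in> edges G" "w \<in> e" by auto
      then obtain u where "e = {w, u}" "u \<noteq> w" by (rule simple_edgeE[OF G(1)])
      then show "e \<in> (\<lambda>u. {w, u}) ` (S - {w})" using e by auto
    qed
    then show ?thesis using that
      by (meson card_image_le card_mono finite_Diff finite_imageI le_trans)
  qed
  show ?case
  proof (cases "edges T = {}")
    \<comment> \<open>Without edges any injection works; a vertex of \<open>G\<close> and its
      neighbours already provide \<open>Suc d\<close> vertices.\<close>
    case True
    obtain w where w: "w \<in> verts G" using G(2) by blast
    have "{e \<in> edges G. w \<in> e \<and> e \<subseteq> verts G} = {e \<in> edges G. w \<in> e}"
      using G(1) by (auto simp: simple_graph_def)
    then have "d \<le> card (verts G - {w})"
      using star[OF finG, of w] G(3)[OF w] by simp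
    then have "card (verts T) \<le> card (verts G)"
      using less.prems(3) w finG by (metis Suc_le_mono card.remove le_trans)
    then obtain f where "inj_on f (verts T)" "f ` verts T \<subseteq> verts G"
      using card_le_inj[OF fin finG] by blast
    then show ?thesis using True by blast
  next
    case False
    obtain v u where uv: "{v, u} \<in> edges T" "u \<noteq> v"
      and leaf: "\<And>e. e \<in> edges T \<Longrightarrow> v \<in> e \<Longrightarrow> e = {v, u}"
      by (rule exists_leaf[OF less.prems(1,2) False]) blast
    let ?H = "induced T (- {v})"
    have v: "v \<in> verts T" "u \<in> verts T"
      using uv less.prems(1) by (auto simp: simple_graph_def)
    have V: "verts ?H = verts T - {v}" by auto
    have cV: "card (verts T) = Suc (card (verts ?H))"
      using V v fin by (metis card.remove)
    have "card (verts ?H) < card (verts T)" "card (verts ?H) \<le> Suc d"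
      using cV less.prems(3) by simp_all
    moreover have "\<nexists>p. is_cycle ?H p"
      using less.prems(2) is_cycle_induced by metis
    ultimately obtain f where f: "inj_on f (verts ?H)" "f ` verts ?H \<subseteq> verts G"
        "\<forall>e\<in>edges ?H. f ` e \<in> edges G"
      using less.hyps[of ?H] simple_graph_induced[OF less.prems(1)] by blast
    let ?I = "f ` verts ?H"
    have fu: "f u \<in> ?I" using v uv by auto
    \<comment> \<open>At most \<open>d\<close> vertices are in use, one of them \<open>f u\<close>
      itself, so the used vertices cannot account for all edges at \<open>f u\<close>.\<close>
    have "card (?I - {f u}) < d"
    proof -
      have "card ?I = card (verts ?H)" using f(1) by (rule card_image)
      moreover have "card ?I = Suc (card (?I - {f u}))"
        using fu fin by (metis V card.remove finite_Diff finite_imageI)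
      ultimately show ?thesis using cV less.prems(3) by linarith
    qed
    moreover have "finite ?I" using fin by simp
    ultimately have "card {e \<in> edges G. f u \<in> e \<and> e \<subseteq> ?I} < d"
      using star[of ?I "f u"] by linarith
    moreover have "d \<le> card {e \<in> edges G. f u \<in> e}"
      using G(3) fu f(2) by blast
    ultimately have "{e \<in> edges G. f u \<in> e \<and> e \<subseteq> ?I} \<noteq> {e \<in> edges G. f u \<in> e}"
      by (metis linorder_not_less)
    then obtain e where e: "e \<in> edges G" "f u \<in> e" "\<not> e \<subseteq> ?I" by blast
    then obtain z where z: "e = {f u, z}" "z \<in> verts G"
      using simple_edgeE[OF G(1)] by metis
    have znot: "z \<notin> ?I" using z e fu by auto
    let ?f = "f(v := z)"
    have "inj_on ?f (verts T)"
      using f(1) znot V v by (auto simp: inj_on_def)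
    moreover have "?f ` verts T \<subseteq> verts G"
      using f(2) z V by auto
    moreover have "?f ` e' \<in> edges G" if "e' \<in> edges T" for e'
    proof (cases "v \<in> e'")
      case True
      then have "?f ` e' = {z, f u}" using leaf[OF that] uv by auto
      then show ?thesis using e z by (simp add: insert_commute)
    next
      case False
      then have "?f ` e' = f ` e'" by (auto simp: image_iff)
      then show ?thesis using f(3) that False by auto
    qed
    ultimately show ?thesis by blast
  qed
qed

text \<open>With more edges, some subgraph has all degrees above \<open>card (verts T) - 2\<close>,
  hence at least \<open>card (verts T) - 1\<close>, which is what the greedy embedding
  needs.\<close>

lemma graph_free_card_edges:
  assumes T: "is_tree T" "2 \<le> card (verts T)" and G: "simple_graph G" "graph_free T G"
  shows "card (edges G) \<le> (card (verts T) - 2) * card (verts G)"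
proof (rule ccontr)
  assume "\<not> ?thesis"
  then have "(card (verts T) - 2) * card (verts G) < card (edges G)" by simp
  then obtain W where W: "W \<subseteq> verts G" "W \<noteq> {}"
      "\<forall>w\<in>W. card (verts T) - 2 < card {e \<in> edges G. e \<subseteq> W \<and> w \<in> e}"
    using min_degree_subgraph[OF G(1)] by meson
  let ?d = "card (verts T) - 1"
  have sT: "simple_graph T" using T by (simp add: is_tree_def)
  have deg: "?d \<le> card {e \<in> edges (induced G W). w \<in> e}" if "w \<in> verts (induced G W)" for w
    using W that T(2) by (fastforce simp: conj_assoc)
  have "verts (induced G W) \<noteq> {}" using W by auto
  then obtain f where f: "inj_on f (verts T)" "f ` verts T \<subseteq> verts (induced G W)"
      "\<forall>e\<in>edges T. f ` e \<in> edges (induced G W)"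
    using forest_embeds[OF sT _ _ simple_graph_induced[OF G(1)], of ?d W] deg T
    by (auto simp: is_tree_def)
  let ?H = "\<lparr>verts = f ` verts T, edges = (`) f ` edges T\<rparr>"
  have e2: "e \<subseteq> verts T" "card e = 2" if "e \<in> edges T" for e
    using that sT by (auto simp: simple_graph_def)
  have "card (f ` e) = 2" if "e \<in> edges T" for e
    using e2[OF that] f(1) by (metis card_image inj_on_subset)
  then have "simple_graph ?H"
    using e2 sT by (auto simp: simple_graph_def)
  then have "is_subgraph ?H G"
    using f by (auto simp: is_subgraph_def)
  moreover have "isomorphic ?H T"
  proof -
    let ?g = "inv_into (verts T) f"
    have "bij_betw ?g (verts ?H) (verts T)"
      using f(1) by (simp add: bij_betw_inv_into inj_on_imp_bij_betw)
    moreover have "{f a, f b} \<in> edges ?H \<longleftrightarrow> {a, b} \<in> edges T"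
      if "a \<in> verts T" "b \<in> verts T" for a b
    proof
      assume "{f a, f b} \<in> edges ?H"
      then obtain e where e: "e \<in> edges T" "f ` e = f ` {a, b}" by auto
      then show "{a, b} \<in> edges T"
        using inj_on_image_eq_iff[OF f(1), of e "{a, b}"] e2 that by auto
    next
      assume "{a, b} \<in> edges T"
      then have "f ` {a, b} \<in> (`) f ` edges T" by (rule imageI)
      then show "{f a, f b} \<in> edges ?H" by simp
    qed
    ultimately show ?thesis
      unfolding isomorphic_def using f(1) by (intro exI[of _ ?g]) auto
  qed
  ultimately show False using G(2) by (auto simp: graph_free_def)
qed

section \<open>Bounds on the extremal numbers\<close>

lemma balanced_bipartite_card_verts:
  assumes "balanced_bipartite n G"
  shows "card (verts G) = 2 * n"
  using assms unfolding balanced_bipartite_def simple_graph_def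
  by (metis card_Un_disjoint finite_Un mult_2)

text \<open>\<open>Max\<close> is unspecified on the empty set; the witness \<open>G0\<close>
  ensures that there is something to maximise over.\<close>

lemma ex_b_le:
  fixes G0 :: "nat ugraph"
  assumes T: "is_tree T" "2 \<le> card (verts T)"
    and G: "balanced_bipartite n G0" "graph_free T G0"
  shows "ex_b n T \<le> (card (verts T) - 2) * (2 * n)"
proof -
  have "card (edges G) \<le> (card (verts T) - 2) * (2 * n)"
    if "balanced_bipartite n G" "graph_free T G" for G :: "nat ugraph"
    using graph_free_card_edges[OF T _ that(2)] that(1) balanced_bipartite_card_verts[OF that(1)]
    by (simp add: balanced_bipartite_def)
  then show ?thesis
    unfolding ex_b_def using G
    by (subst Max_le_iff) (auto intro: finite_balanced_bipartite_sizes)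
qed

lemma ex_b_ge:
  fixes G :: "nat ugraph"
  assumes "balanced_bipartite n G" "graph_free T G"
  shows "card (edges G) \<le> ex_b n T"
  unfolding ex_b_def using assms
  by (intro Max_ge finite_balanced_bipartite_sizes) auto

lemma ex_bc_ge:
  fixes G :: "nat ugraph"
  assumes "balanced_bipartite n G" "graph_connected G" "graph_free T G"
  shows "card (edges G) \<le> ex_bc n T"
  unfolding ex_bc_def using assms
  by (intro Max_ge finite_balanced_bipartite_sizes) auto

section \<open>The two host graphs\<close>

lemma card_even_odd_lessThan:
  "card {x. x < 2 * n \<and> even x} = n" "card {x. x < 2 * n \<and> odd (x::nat)} = n"
proof -
  have "{x. x < 2 * n \<and> even x} = (\<lambda>i. 2 * i) ` {..<n}" by (auto elim!: evenE)
  then show "card {x. x < 2 * n \<and> even x} = n" by (simp add: card_image inj_on_def)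
  have "{x. x < 2 * n \<and> odd x} = (\<lambda>i. 2 * i + 1) ` {..<n}" by (auto elim!: oddE)
  then show "card {x. x < 2 * n \<and> odd x} = n" by (simp add: card_image inj_on_def)
qed

lemma balanced_bipartite_parity:
  fixes E :: "nat set set"
  assumes "\<And>e. e \<in> E \<Longrightarrow> \<exists>x y. e = {x, y} \<and> x < 2 * n \<and> y < 2 * n \<and> (even x \<longleftrightarrow> odd y)"
  shows "balanced_bipartite n \<lparr>verts = {..<2 * n}, edges = E\<rparr>"
proof -
  have parts: "\<exists>x y. e = {x, y} \<and> x < 2 * n \<and> y < 2 * n \<and> even x \<and> odd y" if "e \<in> E" for e
  proof -
    obtain x y where "e = {x, y}" "x < 2 * n" "y < 2 * n" "even x \<longleftrightarrow> odd y"
      using assms \<open>e \<in> E\<close> by blast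
    then show ?thesis
      by (cases "even x") (blast, metis insert_commute)
  qed
  have "\<forall>e\<in>E. e \<subseteq> {..<2 * n} \<and> card e = 2"
  proof
    fix e assume "e \<in> E"
    then obtain x y where "e = {x, y}" "x < 2 * n" "y < 2 * n" "even x" "odd y"
      using parts by blast
    then show "e \<subseteq> {..<2 * n} \<and> card e = 2" by (auto simp: card_2_iff)
  qed
  moreover have "\<forall>e\<in>E. \<exists>a\<in>{x. x < 2 * n \<and> even x}. \<exists>b\<in>{x. x < 2 * n \<and> odd x}. e = {a, b}"
    using parts by blast
  moreover have "{x. x < 2 * n \<and> even x} \<inter> {x. x < 2 * n \<and> odd x} = {}"
    "{x. x < 2 * n \<and> even x} \<union> {x. x < 2 * n \<and> odd x} = {..<2 * n}" by auto
  ultimately show ?thesis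
    unfolding balanced_bipartite_def simple_graph_def
    by (intro conjI exI[of _ "{x. x < 2 * n \<and> even x}"] exI[of _ "{x. x < 2 * n \<and> odd x}"])
      (simp_all add: card_even_odd_lessThan)
qed

text \<open>Stepping repeatedly to a smaller neighbour ends at 0, so every vertex is joined to
  0.\<close>

lemma connected_if_smaller_neighbour:
  fixes G :: "nat ugraph"
  assumes "verts G = {..<N}" "0 < N"
    and step: "\<And>x. 0 < x \<Longrightarrow> x < N \<Longrightarrow> \<exists>y<x. {y, x} \<in> edges G"
  shows "graph_connected G"
proof -
  have "(x, 0) \<in> (adj G)\<^sup>* \<and> (0, x) \<in> (adj G)\<^sup>*" if "x < N" for x
    using that
  proof (induction x rule: less_induct)
    case (less x)
    show ?case
    proof (cases "x = 0")
      case False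
      then obtain y where y: "y < x" "{y, x} \<in> edges G" using step less.prems by blast
      then have "(x, y) \<in> adj G" "(y, x) \<in> adj G" by (simp_all add: adj_def insert_commute)
      then show ?thesis using less.IH[of y] y less.prems
        by (meson converse_rtrancl_into_rtrancl less_trans rtrancl.rtrancl_into_rtrancl)
    qed simp
  qed
  then show ?thesis
    using assms(1,2) unfolding graph_connected_def by (auto intro: rtrancl_trans)
qed

section \<open>Vertex covers and the double star\<close>

definition covers :: "'a set \<Rightarrow> 'a ugraph \<Rightarrow> bool" where
  "covers C G \<longleftrightarrow> finite C \<and> (\<forall>e\<in>edges G. e \<inter> C \<noteq> {})"

text \<open>If \<open>G\<close> contained a copy of \<open>T\<close>, the isomorphism would carry a
  cover of \<open>G\<close> to a cover of \<open>T\<close> that is no larger.\<close>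

lemma graph_free_if_not_covered:
  assumes T: "simple_graph T" and q: "\<And>C. covers C T \<Longrightarrow> q < card C"
    and C: "covers C G" "card C \<le> q"
  shows "graph_free T G"
  unfolding graph_free_def
proof
  assume "\<exists>H. is_subgraph H G \<and> isomorphic H T"
  then obtain H f where H: "is_subgraph H G" and f: "bij_betw f (verts H) (verts T)"
    and iso: "\<forall>u\<in>verts H. \<forall>v\<in>verts H. {u, v} \<in> edges H \<longleftrightarrow> {f u, f v} \<in> edges T"
    unfolding isomorphic_def by blast
  have "covers (f ` C) T"
    unfolding covers_def
  proof (intro conjI ballI)
    fix e assume e: "e \<in> edges T"
    then have "card e = 2" "e \<subseteq> verts T" using T by (auto simp: simple_graph_def)
    then obtain x y where "e = {x, y}" "x \<in> verts T" "y \<in> verts T"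
      by (auto simp: card_2_iff)
    then obtain a b where "e = {f a, f b}" "a \<in> verts H" "b \<in> verts H"
      by (metis bij_betw_imp_surj_on[OF f] imageE)
    moreover from this e iso have "{a, b} \<in> edges G"
      using H unfolding is_subgraph_def by blast
    then have "{a, b} \<inter> C \<noteq> {}" using C(1) unfolding covers_def by blast
    ultimately show "e \<inter> f ` C \<noteq> {}" by auto
  qed (use C(1) in \<open>simp add: covers_def\<close>)
  then have "q < card (f ` C)" by (rule q)
  moreover have "card (f ` C) \<le> card C"
    using C(1) by (intro card_image_le) (simp add: covers_def)
  ultimately show False using C(2) by simp
qed

text \<open>These are the edges of the complete bipartite graph between even and odd numbers that
  meet \<open>{..<q}\<close>; \<open>x\<close> names the smaller end. For \<open>q = 2\<close> this
  is the usual double star with centres 0 and 1.\<close>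

definition double_star :: "nat \<Rightarrow> nat \<Rightarrow> nat ugraph" where
  "double_star q n = \<lparr>verts = {..<2 * n},
     edges = {{x, y} |x y. x < y \<and> x < q \<and> y < 2 * n \<and> (even x \<longleftrightarrow> odd y)}\<rparr>"

lemma double_star_balanced: "balanced_bipartite n (double_star q n)"
  unfolding double_star_def
proof (rule balanced_bipartite_parity)
  fix e assume "e \<in> {{x, y} |x y. x < y \<and> x < q \<and> y < 2 * n \<and> (even x \<longleftrightarrow> odd y)}"
  then obtain x y where "e = {x, y}" "x < y" "y < 2 * n" "even x \<longleftrightarrow> odd y" by blast
  moreover from this have "x < 2 * n" by simp
  ultimately show "\<exists>x y. e = {x, y} \<and> x < 2 * n \<and> y < 2 * n \<and> (even x \<longleftrightarrow> odd y)"
    by blast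
qed

lemma double_star_connected:
  assumes "2 \<le> q" "0 < n"
  shows "graph_connected (double_star q n)"
proof (rule connected_if_smaller_neighbour[where N = "2 * n"])
  fix x assume x: "0 < x" "x < 2 * n"
  let ?y = "if odd x then 0 else 1 :: nat"
  have "?y < x" "?y < q" "even ?y \<longleftrightarrow> odd x" using x assms by (auto elim!: evenE)
  then have "{?y, x} \<in> edges (double_star q n)"
    using x unfolding double_star_def ugraph.simps by blast
  then show "\<exists>y<x. {y, x} \<in> edges (double_star q n)" using \<open>?y < x\<close> by blast
qed (use assms in \<open>auto simp: double_star_def\<close>)

text \<open>Each \<open>x\<close> below \<open>q\<close> is joined to the member of opposite parity
  in every pair \<open>2 * j\<close>, \<open>2 * j + 1\<close>. Taking only \<open>j\<close> from
  \<open>q\<close> on puts the second end above all centres, so no edge is counted twice.\<close>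

lemma double_star_card_edges: "q * (n - q) \<le> card (edges (double_star q n))"
proof -
  let ?f = "\<lambda>(x::nat, j::nat). {x, 2 * j + (if even x then 1 else 0)}"
  have "inj_on ?f ({..<q} \<times> {q..<n})"
  proof (rule inj_onI)
    fix z z' assume z: "z \<in> {..<q} \<times> {q..<n}" "z' \<in> {..<q} \<times> {q..<n}" "?f z = ?f z'"
    obtain x j x' j' where zz: "z = (x, j)" "z' = (x', j')" by (metis surj_pair)
    have lt: "x < q" "q \<le> j" "x' < q" "q \<le> j'"
      and eq: "{x, 2 * j + (if even x then 1 else 0)} = {x', 2 * j' + (if even x' then 1 else 0)}"
      using z unfolding zz by auto
    have "x = x'" using eq lt by (auto simp only: doubleton_eq_iff)
    then show "z = z'" using eq lt by (auto simp: zz doubleton_eq_iff)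
  qed
  then have "q * (n - q) = card (?f ` ({..<q} \<times> {q..<n}))"
    by (simp add: card_image)
  also have "\<dots> \<le> card (edges (double_star q n))"
  proof (rule card_mono)
    show "finite (edges (double_star q n))"
      using double_star_balanced by (simp add: balanced_bipartite_def simple_graph_finite_edges)
    have "{x, 2 * j + (if even x then 1 else 0)} \<in> edges (double_star q n)"
      if "x < q" "q \<le> j" "j < n" for x j
    proof -
      let ?y = "2 * j + (if even x then 1 else 0)"
      have "x < ?y \<and> x < q \<and> ?y < 2 * n \<and> (even x \<longleftrightarrow> odd ?y)" using that by auto
      then show ?thesis unfolding double_star_def ugraph.simps by blast
    qed
    then show "?f ` ({..<q} \<times> {q..<n}) \<subseteq> edges (double_star q n)" by auto
  qed
  finally show ?thesis .
qed

lemma double_star_free: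
  assumes "simple_graph T" "\<And>C. covers C T \<Longrightarrow> q < card C"
  shows "graph_free T (double_star q n)"
proof (rule graph_free_if_not_covered[OF assms, where C = "{..<q}"])
  show "covers {..<q} (double_star q n)" by (auto simp: covers_def double_star_def)
qed auto

section \<open>The comb\<close>

text \<open>
  The comb consists of \<open>m\<close> units of \<open>P = D + L + 2 * s\<close> consecutive numbers.  In a unit the residues
  below \<open>D\<close> form a piece of the spine, the residues from \<open>D\<close> to \<open>D + L - 1\<close> a leg, and the remaining
  ones a block, which is a complete bipartite graph with respect to parity.
\<close>

locale comb =
  fixes D L s m :: nat
  assumes even_D: "even D" and even_L: "even L" and D: "2 \<le> D" and L: "0 < L"
    and s: "0 < s" and m: "0 < m"
begin

definition P :: nat where "P = D + L + 2 * s"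

text \<open>The bound on the residue concerns the lower end. The last path edge of a unit therefore
  joins the end of the leg to the first block vertex, of residue \<open>D + L\<close>.\<close>

definition path_edges :: "nat set set" where
  "path_edges = {{x, Suc x} |x. x < m * P \<and> x mod P < D + L}"

definition block_edges :: "nat set set" where
  "block_edges = {{x, y} |x y. x < m * P \<and> y < m * P \<and> x div P = y div P \<and>
     D + L \<le> x mod P \<and> D + L \<le> y mod P \<and> even x \<and> odd y}"

text \<open>The next unit is attached at residue \<open>D - 1\<close>, where the leg also branches
  off. Between two consecutive links lie the \<open>D - 1\<close> path edges of a spine
  piece.\<close>

definition links :: "nat set set" where
  "links = {{i * P + (D - 1), Suc i * P} |i. Suc i < m}"

definition G :: "nat ugraph" where
  "G = \<lparr>verts = {..<m * P}, edges = path_edges \<union> block_edges \<union> links\<rparr>"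

lemma P_pos: "0 < P" and even_P: "even P" and D_less_P: "D < P" and DL_less_P: "D + L < P"
  using even_D even_L D s by (simp_all add: P_def)

lemma unit_div_mod:
  assumes "r < P"
  shows "(i * P + r) div P = i" "(i * P + r) mod P = r"
  using assms by auto

lemma in_unit:
  assumes "x < m * P"
  shows "x div P < m" "Suc (x div P) * P \<le> m * P"
proof -
  show *: "x div P < m" using assms by (simp add: less_mult_imp_div_less)
  show "Suc (x div P) * P \<le> m * P" using * by (intro mult_le_mono1) simp
qed

lemma path_edge_unit:
  assumes "x < m * P" "x mod P < D + L"
  shows "Suc x < m * P" "Suc x div P = x div P" "Suc x mod P = Suc (x mod P)"
proof -
  have lt: "Suc (x mod P) < P" using assms(2) DL_less_P by simp
  have eq: "Suc x = x div P * P + Suc (x mod P)" by simp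
  show "Suc x div P = x div P" "Suc x mod P = Suc (x mod P)"
    by (subst eq, rule unit_div_mod[OF lt])+
  have "Suc x = x div P * P + Suc (x mod P)" by (fact eq)
  also have "\<dots> < x div P * P + P" using lt by (rule add_strict_left_mono)
  also have "\<dots> = Suc (x div P) * P" by simp
  also have "\<dots> \<le> m * P" using in_unit[OF assms(1)] by simp
  finally show "Suc x < m * P" .
qed

lemma link_less: "Suc i < m \<Longrightarrow> Suc i * P < m * P" "i * P + (D - 1) < Suc i * P"
  using P_pos D_less_P by (simp_all del: mult_Suc) simp

lemma balanced: "balanced_bipartite (m * (P div 2)) G"
proof -
  have N: "2 * (m * (P div 2)) = m * P" using even_P by auto
  have "\<exists>x y. e = {x, y} \<and> x < m * P \<and> y < m * P \<and> (even x \<longleftrightarrow> odd y)"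
    if "e \<in> path_edges \<union> block_edges \<union> links" for e
    using that
  proof (elim UnE)
    assume "e \<in> path_edges"
    then obtain x where x: "e = {x, Suc x}" "x < m * P" "Suc x < m * P"
      using path_edge_unit(1) by (auto simp: path_edges_def)
    then show ?thesis by (intro exI[of _ x] exI[of _ "Suc x"]) simp
  next
    assume "e \<in> links"
    then obtain i where i: "e = {i * P + (D - 1), Suc i * P}" "Suc i < m" by (auto simp: links_def)
    have "even (Suc i * P)" "odd (i * P + (D - 1))" using even_P even_D D by auto
    moreover have "i * P + (D - 1) < m * P"
      using link_less[of i] i by linarith
    ultimately show ?thesis
      using i link_less(1)[of i] by blast
  qed (auto simp: block_edges_def)
  then show ?thesis
    using balanced_bipartite_parity[of "path_edges \<union> block_edges \<union> links" "m * (P div 2)"]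
    unfolding G_def N by blast
qed

text \<open>The smaller neighbour of \<open>x\<close> is its predecessor, inside blocks too since
  consecutive numbers differ in parity. Only the start of a unit uses a link instead.\<close>

lemma connected: "graph_connected G"
proof (rule connected_if_smaller_neighbour[where N = "m * P"])
  fix x assume x: "0 < x" "x < m * P"
  show "\<exists>y<x. {y, x} \<in> edges G"
  proof (cases "x mod P = 0")
    case True
    then obtain i where i: "x = i * P" by (metis mult.commute mod_0_imp_dvd dvdE)
    with x obtain j where "i = Suc j" by (cases i) auto
    moreover have "Suc j < m"
      using x i \<open>i = Suc j\<close> P_pos by (metis mult_less_cancel2)
    ultimately have "{j * P + (D - 1), x} \<in> links" "j * P + (D - 1) < x"
      using i link_less[of j] by (auto simp: links_def simp del: mult_Suc)
    then show ?thesis by (auto simp: G_def)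
  next
    case False
    then obtain y where y: "x = Suc y" by (metis mod_0 not0_implies_Suc)
    have eq: "x mod P = Suc (y mod P)" using False unfolding y by (simp add: mod_Suc split: if_splits)
    then have deq: "x div P = y div P" using False y by (simp add: div_Suc)
    have "{y, x} \<in> path_edges \<union> block_edges"
    proof (cases "y mod P < D + L")
      case True
      then show ?thesis using x y by (auto simp: path_edges_def)
    next
      case F: False
      show ?thesis
      proof (cases "even x")
        case True
        then have "{x, y} \<in> block_edges"
          using F x y eq deq unfolding block_edges_def by fastforce
        then show ?thesis by (simp add: insert_commute)
      next
        case False
        then have "{y, x} \<in> block_edges"
          using F x y eq deq unfolding block_edges_def by fastforce
        then show ?thesis by simp
      qed
    qed
    then show ?thesis using y by (auto simp: G_def)
  qed
qed (use m P_pos in \<open>auto simp: G_def\<close>)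

lemma finite_edges: "finite (edges G)"
  using balanced by (simp add: balanced_bipartite_def simple_graph_finite_edges)

text \<open>Only block edges are counted: each of the \<open>m\<close> blocks has \<open>s\<close>
  even and \<open>s\<close> odd vertices. The indices \<open>i\<close>, \<open>a\<close>,
  \<open>b\<close> are recovered by parity, quotient and remainder.\<close>

lemma card_edges: "m * s\<^sup>2 \<le> card (edges G)"
proof -
  let ?f = "\<lambda>(i, a, b). {i * P + (D + L + 2 * a), i * P + (D + L + 2 * b + 1)}"
  have ev: "even (i * P + (D + L + 2 * a))" "odd (i * P + (D + L + 2 * b + 1))" for i a b
    using even_P even_D even_L by auto
  have small: "D + L + 2 * a < P" "D + L + 2 * a + 1 < P" if "a < s" for a
    using that by (simp_all add: P_def)
  have inj: "inj_on ?f ({..<m} \<times> {..<s} \<times> {..<s})"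
  proof (rule inj_onI)
    fix z z' assume z: "z \<in> {..<m} \<times> {..<s} \<times> {..<s}" "z' \<in> {..<m} \<times> {..<s} \<times> {..<s}" "?f z = ?f z'"
    obtain i a b i' a' b' where zz: "z = (i, a, b)" "z' = (i', a', b')" by (metis surj_pair)
    have lt: "a < s" "b < s" "a' < s" "b' < s"
      and eq: "{i * P + (D + L + 2 * a), i * P + (D + L + 2 * b + 1)} =
        {i' * P + (D + L + 2 * a'), i' * P + (D + L + 2 * b' + 1)}"
      using z unfolding zz by auto
    have 1: "i * P + (D + L + 2 * a) = i' * P + (D + L + 2 * a')"
      and 2: "i * P + (D + L + 2 * b + 1) = i' * P + (D + L + 2 * b' + 1)"
      using eq ev by (metis doubleton_eq_iff)+
    have "i = i'" "D + L + 2 * a = D + L + 2 * a'" "D + L + 2 * b + 1 = D + L + 2 * b' + 1"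
      using 1 2 unit_div_mod small lt by metis+
    then show "z = z'" by (simp add: zz)
  qed
  have "m * s\<^sup>2 = card (?f ` ({..<m} \<times> {..<s} \<times> {..<s}))"
    by (simp only: card_image[OF inj]) (simp add: power2_eq_square)
  also have "\<dots> \<le> card (edges G)"
  proof (rule card_mono[OF finite_edges])
    have "{i * P + (D + L + 2 * a), i * P + (D + L + 2 * b + 1)} \<in> block_edges"
      if "i < m" "a < s" "b < s" for i a b
    proof -
      have "i * P + r < m * P" if "r < P" for r
      proof -
        have "i * P + r < Suc i * P" using that by simp
        also have "\<dots> \<le> m * P" using \<open>i < m\<close> by (intro mult_le_mono1) simp
        finally show ?thesis .
      qed
      moreover have "D + L + 2 * a < P" "D + L + 2 * b + 1 < P" using small that by auto
      moreover have "D + L \<le> D + L + 2 * a" "D + L \<le> D + L + 2 * b + 1" by simp_all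
      ultimately have "i * P + (D + L + 2 * a) < m * P \<and> i * P + (D + L + 2 * b + 1) < m * P \<and>
          (i * P + (D + L + 2 * a)) div P = (i * P + (D + L + 2 * b + 1)) div P \<and>
          D + L \<le> (i * P + (D + L + 2 * a)) mod P \<and> D + L \<le> (i * P + (D + L + 2 * b + 1)) mod P \<and>
          even (i * P + (D + L + 2 * a)) \<and> odd (i * P + (D + L + 2 * b + 1))"
        using ev by (simp only: unit_div_mod simp_thms)
      then show ?thesis unfolding block_edges_def by blast
    qed
    then show "?f ` ({..<m} \<times> {..<s} \<times> {..<s}) \<subseteq> edges G" by (auto simp: G_def)
  qed
  finally show ?thesis .
qed

text \<open>Every leg edge is a bridge. The far side consists of the rest of the leg and the whole
  block: block edges stay inside, and links have residues \<open>D - 1\<close> and 0, which are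
  outside.\<close>

lemma crossing_leg:
  assumes r: "D - 1 \<le> r" "r < D + L" and e: "{u, v} \<in> edges G"
    and u: "u \<in> {i * P + Suc r..<Suc i * P}" and v: "v \<notin> {i * P + Suc r..<Suc i * P}"
  shows "{u, v} = {i * P + r, Suc (i * P + r)}"
proof -
  have ui: "u div P = i" "u mod P \<ge> Suc r"
  proof -
    have "u div P = i" using u by (intro div_nat_eqI) (auto simp: mult.commute[of P])
    then show "u div P = i" "u mod P \<ge> Suc r"
      using u div_mult_mod_eq[of u P] by auto
  qed
  have vi: "v div P \<noteq> i \<or> v mod P \<le> r"
  proof (rule ccontr)
    assume "\<not> ?thesis"
    then have "v = i * P + v mod P" "Suc r \<le> v mod P"
      using div_mult_mod_eq[of v P] by auto
    moreover have "v mod P < P" using P_pos by simp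
    ultimately show False using v by auto
  qed
  consider "{u, v} \<in> path_edges" | "{u, v} \<in> block_edges" | "{u, v} \<in> links"
    using e by (auto simp: G_def)
  then show ?thesis
  proof cases
    case 1
    then obtain x where x: "{u, v} = {x, Suc x}" "x < m * P" "x mod P < D + L"
      by (auto simp: path_edges_def)
    have dv: "Suc x div P = x div P" "Suc x mod P = Suc (x mod P)"
      using path_edge_unit x by auto
    have "x mod P = r \<and> x div P = i"
      using x(1) ui vi dv by (auto simp: doubleton_eq_iff)
    then have "x = i * P + r" by (metis div_mult_mod_eq)
    then show ?thesis using x by simp
  next
    case 2
    then show ?thesis using ui vi r by (auto simp: block_edges_def doubleton_eq_iff)
  next
    case 3
    then obtain j where j: "{u, v} = {j * P + (D - 1), Suc j * P}" by (auto simp: links_def)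
    have "(j * P + (D - 1)) mod P = D - 1" "(Suc j * P) mod P = 0"
      using D_less_P by auto
    then show ?thesis using j ui r by (auto simp: doubleton_eq_iff)
  qed
qed

text \<open>Cutting the numbers inside a spine piece splits no block, since a block lies within one
  unit beyond its spine piece. It splits no link, since a link runs from residue
  \<open>D - 1\<close> to the start of the next unit.\<close>

lemma crossing_spine:
  assumes r: "r < D - 1" and e: "{u, v} \<in> edges G"
    and u: "u \<le> i * P + r" and v: "\<not> v \<le> i * P + r"
  shows "{u, v} = {i * P + r, Suc (i * P + r)}"
proof -
  have dm: "(i * P + r) div P = i" "(i * P + r) mod P = r"
    using r D_less_P by auto
  consider "{u, v} \<in> path_edges" | "{u, v} \<in> block_edges" | "{u, v} \<in> links"
    using e by (auto simp: G_def)
  then show ?thesis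
  proof cases
    case 1
    then show ?thesis using u v by (auto simp: path_edges_def doubleton_eq_iff)
  next
    case 2
    then have uv: "u div P = v div P" "D + L \<le> u mod P"
      by (auto simp: block_edges_def doubleton_eq_iff)
    have "u div P \<le> i" using div_le_mono[OF u, of P] dm by simp
    moreover have "i \<le> v div P" using div_le_mono[of "i * P + r" v P] v dm by simp
    ultimately have "u div P = i" using uv by simp
    then have "i * P + (D + L) \<le> u" using uv(2) div_mult_mod_eq[of u P] by auto
    then show ?thesis using u r by simp
  next
    case 3
    then obtain j where j: "{u, v} = {j * P + (D - 1), Suc j * P}" by (auto simp: links_def)
    have *: "u = j * P + (D - 1)" "v = Suc j * P"
      using j u v link_less(2)[of j] by (auto simp: doubleton_eq_iff)
    have "j \<le> i" using div_le_mono[OF u, of P] dm * D_less_P by simp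
    moreover have "i < Suc j"
    proof (rule ccontr)
      assume "\<not> ?thesis"
      then have "Suc j * P \<le> i * P" by (intro mult_le_mono1) simp
      then show False using v * by simp
    qed
    ultimately have "j = i" by simp
    then show ?thesis using * u r by simp
  qed
qed

end

section \<open>Trees with a small vertex cover inside the comb\<close>

context comb
begin

text \<open>The edges of \<open>H\<close> are counted by kind: at most \<open>2 * t\<close> path
  edges, \<open>2 * s\<close> block edges and \<open>2 * t div (D - 1) + 1\<close> links. One more
  is added in passing from edges to vertices.\<close>

lemma tree_in_comb_card:
  assumes H: "is_tree H" "is_subgraph H G" and C: "covers C H" "card C \<le> t" and t: "t < L"
  shows "card (verts H) \<le> 2 * t + 2 * t div (D - 1) + 2 * s + 2"
proof -
  have sH: "simple_graph H" and cH: "graph_connected H" and acyc: "\<nexists>p. is_cycle H p"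
    using H by (auto simp: is_tree_def)
  have finE: "finite (edges H)" by (rule simple_graph_finite_edges[OF sH])
  have VH: "verts H \<subseteq> {..<m * P}" and EH: "edges H \<subseteq> path_edges \<union> block_edges \<union> links"
    and EG: "edges H \<subseteq> edges G"
    using H(2) by (auto simp: is_subgraph_def G_def)
  define X where "X = {x. x < m * P \<and> x mod P < D + L \<and> {x, Suc x} \<in> edges H}"
  have finX: "finite X" by (rule finite_subset[of _ "{..<m * P}"]) (auto simp: X_def)
  \<comment> \<open>\<open>X\<close> records path edges by their lower ends. A vertex of the cover
    lies on at most two path edges, one starting at it and one at its predecessor.\<close>
  have "X \<subseteq> C \<union> (\<lambda>y. y - 1) ` C"
  proof
    fix x assume "x \<in> X"
    then have "{x, Suc x} \<inter> C \<noteq> {}" using C(1) by (auto simp: X_def covers_def)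
    then show "x \<in> C \<union> (\<lambda>y. y - 1) ` C" by force
  qed
  moreover have finC: "finite C" using C(1) by (simp add: covers_def)
  ultimately have "card X \<le> card C + card ((\<lambda>y. y - 1) ` C)"
    by (meson card_Un_le card_mono finite_UnI finite_imageI le_trans)
  then have X: "card X \<le> 2 * t"
    using card_image_le[OF finC, of "\<lambda>y. y - 1"] C(2) by linarith
  have inX: "i * P + r \<in> X" if "i < m" "r < D + L" "{i * P + r, Suc (i * P + r)} \<in> edges H" for i r
  proof -
    have "r < P" using that DL_less_P by simp
    moreover from this have "i * P + r < Suc i * P" by simp
    moreover have "Suc i * P \<le> m * P" using that(1) by (intro mult_le_mono1) simp
    ultimately show ?thesis using that unit_div_mod(2)[of r i] by (simp add: X_def)
  qed

  \<comment> \<open>A copy that has a vertex in a block and another outside its unit must cross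
    every bridge of the leg.\<close>
  have leg: "{a div P * P + D..<a div P * P + D + L} \<subseteq> X"
    if a: "a \<in> verts H" "D + L \<le> a mod P" and b: "b \<in> verts H" "b div P \<noteq> a div P" for a b
  proof
    fix z assume z: "z \<in> {a div P * P + D..<a div P * P + D + L}"
    define r where "r = z - a div P * P"
    have zr: "z = a div P * P + r" and r: "D \<le> r" "r < D + L"
      using z by (auto simp: r_def)
    let ?S = "{a div P * P + Suc r..<Suc (a div P) * P}"
    have "a \<in> ?S"
    proof -
      have "a = a div P * P + a mod P" by simp
      moreover have "a mod P < P" using P_pos by simp
      ultimately have "a div P * P + Suc r \<le> a" "a < a div P * P + P" using a(2) r by linarith+
      then show ?thesis by simp
    qed
    moreover have "b \<notin> ?S"
    proof
      assume "b \<in> ?S"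
      then have "b div P = a div P" by (intro div_nat_eqI) (auto simp: mult.commute[of P])
      then show False using b by simp
    qed
    ultimately obtain u v where uv: "{u, v} \<in> edges H" "u \<in> ?S" "v \<notin> ?S"
      using connected_crossing_edge[OF cH a(1) _ b(1)] by blast
    have "{u, v} = {a div P * P + r, Suc (a div P * P + r)}"
      by (rule crossing_leg) (use uv r EG in auto)
    then have "{a div P * P + r, Suc (a div P * P + r)} \<in> edges H" using uv(1) by simp
    then show "z \<in> X" using inX r in_unit(1)[of a] a VH unfolding zr by auto
  qed
  \<comment> \<open>Vertices in two different blocks would force both legs into \<open>X\<close>,
    giving \<open>2 * L\<close> elements where at most \<open>2 * t\<close> are possible.\<close>
  have one_block: "a div P = b div P"
    if ab: "a \<in> verts H" "D + L \<le> a mod P" "b \<in> verts H" "D + L \<le> b mod P" for a b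
  proof (rule ccontr)
    assume ne: "a div P \<noteq> b div P"
    let ?I = "\<lambda>i. {i * P + D..<i * P + D + L}"
    have unit: "z div P = i" if "z \<in> ?I i" for z i
      using that DL_less_P by (intro div_nat_eqI) (auto simp: mult.commute[of P])
    have "?I (a div P) \<inter> ?I (b div P) = {}"
    proof (rule ccontr)
      assume "?I (a div P) \<inter> ?I (b div P) \<noteq> {}"
      then obtain z where "z \<in> ?I (a div P)" "z \<in> ?I (b div P)" by blast
      then show False using unit ne by metis
    qed
    then have "card (?I (a div P) \<union> ?I (b div P)) = 2 * L"
      by (subst card_Un_disjoint) auto
    moreover have "?I (a div P) \<union> ?I (b div P) \<subseteq> X"
      using leg[OF ab(1,2) ab(3)] leg[OF ab(3,4) ab(1)] ne by auto
    ultimately have "2 * L \<le> card X" using card_mono[OF finX] by metis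
    then show False using X t by simp
  qed

  define W where "W = {x. D + L \<le> x mod P}"
  \<comment> \<open>All block vertices of \<open>H\<close> lie in one block of \<open>2 * s\<close>
    vertices, and a forest on them has no more edges than vertices.\<close>
  have blocks: "card (edges H \<inter> block_edges) \<le> 2 * s"
  proof (cases "verts H \<inter> W = {}")
    case True
    have "edges H \<inter> block_edges = {}"
    proof (rule ccontr)
      assume "\<not> ?thesis"
      then obtain e where e: "e \<in> edges H" "e \<in> block_edges" by blast
      then obtain x where "x \<in> e" "x \<in> W" by (auto simp: block_edges_def W_def)
      then show False using e True sH by (auto simp: simple_graph_def)
    qed
    then show ?thesis by simp
  next
    case False
    then obtain a where a: "a \<in> verts H" "D + L \<le> a mod P" by (auto simp: W_def)
    have "verts H \<inter> W \<subseteq> {a div P * P + (D + L)..<Suc (a div P) * P}"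
    proof
      fix b assume "b \<in> verts H \<inter> W"
      then have b: "D + L \<le> b mod P" "b div P = a div P"
        using one_block[of b a] a by (auto simp: W_def)
      have "b = a div P * P + b mod P" using b(2) div_mult_mod_eq[of b P] by simp
      then show "b \<in> {a div P * P + (D + L)..<Suc (a div P) * P}"
        using b(1) mod_less_divisor[OF P_pos, of b] by auto
    qed
    then have "card (verts H \<inter> W) \<le> card {a div P * P + (D + L)..<Suc (a div P) * P}"
      by (intro card_mono) auto
    also have "\<dots> = 2 * s" by (simp add: P_def)
    finally have "card (verts (induced H W)) \<le> 2 * s" by simp
    moreover have "card (edges (induced H W)) \<le> card (verts (induced H W))"
      using forest_card_edges[OF simple_graph_induced[OF sH]] acyc is_cycle_induced by metis
    moreover have "card (edges H \<inter> block_edges) \<le> card (edges (induced H W))"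
      by (intro card_mono) (use finE in \<open>auto simp: block_edges_def W_def\<close>)
    ultimately show ?thesis by linarith
  qed

  define I where "I = {i. Suc i < m \<and> {i * P + (D - 1), Suc i * P} \<in> edges H}"
  have finI: "finite I" by (rule finite_subset[of _ "{..<m}"]) (auto simp: I_def)
  \<comment> \<open>If two links are used, connectedness forces the copy through every spine piece
    between them.\<close>
  have spine: "l * P + r \<in> X"
    if ij: "i \<in> I" "j \<in> I" "i < l" "l \<le> j" and r: "r < D - 1" for i j l r
  proof -
    have links_ij: "{i * P + (D - 1), Suc i * P} \<in> edges H" "{j * P + (D - 1), Suc j * P} \<in> edges H"
      using ij(1,2) by (simp_all only: I_def mem_Collect_eq)
    have ends: "x \<in> verts H" "y \<in> verts H" if "{x, y} \<in> edges H" for x y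
      using that sH by (auto simp: simple_graph_def)
    have "Suc i * P \<in> verts H" "j * P + (D - 1) \<in> verts H"
      using ends(2)[OF links_ij(1)] ends(1)[OF links_ij(2)] .
    moreover have "Suc i * P \<le> l * P" "l * P \<le> j * P"
      using ij by (auto intro!: mult_le_mono1 simp del: mult_Suc)
    then have "Suc i * P \<in> {..l * P + r}" "j * P + (D - 1) \<notin> {..l * P + r}"
      unfolding atMost_iff using r by linarith+
    ultimately obtain u v where uv: "{u, v} \<in> edges H" "u \<in> {..l * P + r}" "v \<notin> {..l * P + r}"
      using connected_crossing_edge[OF cH] by blast
    have "{u, v} = {l * P + r, Suc (l * P + r)}"
      by (rule crossing_spine) (use uv r EG in auto)
    then show ?thesis using inX[of l r] uv(1) ij r by (auto simp: I_def)
  qed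
  \<comment> \<open>Each unit after the first used link, up to the last one, contributes
    \<open>D - 1\<close> elements to \<open>X\<close>. The summand 1 accounts for the first
    link.\<close>
  have linksI: "card I \<le> 2 * t div (D - 1) + 1"
  proof (cases "I = {}")
    case False
    let ?a = "Min I" and ?b = "Max I"
    have ab: "?a \<in> I" "?b \<in> I" "?a \<le> ?b" using False finI by auto
    have "I \<subseteq> {?a..?b}" using finI by auto
    then have "card I \<le> card {?a..?b}" by (intro card_mono) auto
    then have 1: "card I \<le> ?b - ?a + 1" using ab by simp
    let ?f = "\<lambda>(l, r). l * P + r"
    have "inj_on ?f ({?a<..?b} \<times> {..<D - 1})"
    proof (rule inj_onI)
      fix z z' assume z: "z \<in> {?a<..?b} \<times> {..<D - 1}" "z' \<in> {?a<..?b} \<times> {..<D - 1}" "?f z = ?f z'"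
      then obtain l r l' r' where "z = (l, r)" "z' = (l', r')" "r < P" "r' < P"
        "l * P + r = l' * P + r'" using D_less_P by (cases z; cases z') auto
      then show "z = z'" using unit_div_mod by (metis (no_types))
    qed
    then have "(?b - ?a) * (D - 1) = card (?f ` ({?a<..?b} \<times> {..<D - 1}))"
      by (simp add: card_image)
    also have "\<dots> \<le> card X"
      by (intro card_mono finX) (use spine[OF ab(1,2)] in auto)
    finally have "(?b - ?a) * (D - 1) \<le> 2 * t" using X by simp
    then have "?b - ?a \<le> 2 * t div (D - 1)"
      using D by (simp add: less_eq_div_iff_mult_less_eq)
    then show ?thesis using 1 by simp
  qed simp

  have "edges H = (edges H \<inter> path_edges) \<union> (edges H \<inter> block_edges) \<union> (edges H \<inter> links)"
    using EH by blast
  also have "card \<dots> \<le> card (edges H \<inter> path_edges) + card (edges H \<inter> block_edges) + card (edges H \<inter> links)"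
    by (meson add_le_mono1 card_Un_le le_trans)
  also have "card (edges H \<inter> path_edges) \<le> card ((\<lambda>x. {x, Suc x}) ` X)"
    by (intro card_mono finite_imageI finX) (auto simp: path_edges_def X_def)
  also have "\<dots> \<le> 2 * t" using X card_image_le[OF finX] le_trans by blast
  also have "card (edges H \<inter> links) \<le> card ((\<lambda>i. {i * P + (D - 1), Suc i * P}) ` I)"
    by (intro card_mono finite_imageI finI) (auto simp: links_def I_def)
  also have "\<dots> \<le> 2 * t div (D - 1) + 1" using linksI card_image_le[OF finI] le_trans by blast
  finally have "card (edges H) \<le> 2 * t + 2 * s + (2 * t div (D - 1) + 1)" using blocks by simp
  then show ?thesis using connected_card_edges[OF sH cH] by simp
qed

text \<open>A cover of \<open>T\<close> is pulled back along the isomorphism to a cover of the copy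
  \<open>H\<close> that is no larger, so the vertex bound applies to \<open>H\<close>.\<close>

lemma comb_free:
  assumes T: "is_tree T" and C: "covers C T" "card C \<le> t" and t: "t < L"
    and big: "2 * t + 2 * t div (D - 1) + 2 * s + 2 < card (verts T)"
  shows "graph_free T G"
  unfolding graph_free_def
proof
  assume "\<exists>H. is_subgraph H G \<and> isomorphic H T"
  then obtain H f where H: "is_subgraph H G" and f: "bij_betw f (verts H) (verts T)"
    and iso: "\<forall>u\<in>verts H. \<forall>v\<in>verts H. {u, v} \<in> edges H \<longleftrightarrow> {f u, f v} \<in> edges T"
    unfolding isomorphic_def by blast
  have sH: "simple_graph H" using H by (simp add: is_subgraph_def)
  let ?C = "{x \<in> verts H. f x \<in> C}"
  have inj: "inj_on f ?C" by (rule inj_on_subset[OF bij_betw_imp_inj_on[OF f]]) auto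
  have finC: "finite C" using C(1) by (simp add: covers_def)
  have "covers ?C H"
    unfolding covers_def
  proof (intro conjI ballI)
    show "finite ?C" using sH by (simp add: simple_graph_def)
    fix e assume e: "e \<in> edges H"
    then have "card e = 2" "e \<subseteq> verts H" using sH by (auto simp: simple_graph_def)
    then obtain a b where ab: "e = {a, b}" "a \<in> verts H" "b \<in> verts H"
      by (auto simp: card_2_iff)
    then have "{f a, f b} \<in> edges T" using e iso by blast
    then have "{f a, f b} \<inter> C \<noteq> {}" using C(1) by (auto simp: covers_def)
    then show "e \<inter> ?C \<noteq> {}" using ab by auto
  qed
  moreover have "card ?C \<le> t"
    using card_inj_on_le[OF inj _ finC] C(2) by fastforce
  ultimately have "card (verts H) \<le> 2 * t + 2 * t div (D - 1) + 2 * s + 2"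
    using tree_in_comb_card[OF isomorphic_tree[OF sH f iso T] H] t by blast
  then show False using big bij_betw_same_card[OF f] by simp
qed

end

section \<open>The lower bounds\<close>

lemma dense_host:
  assumes T: "is_tree T" and k: "20000 \<le> card (verts T)"
  shows "\<exists>n\<ge>N. 0 < n \<and> (\<exists>G :: nat ugraph. balanced_bipartite n G \<and> graph_connected G \<and>
    graph_free T G \<and> 0.2074 * (real (card (verts T)) - 2) * real n \<le> real (card (edges G)))"
proof -
  \<comment> \<open>The double star has density about \<open>t / k\<close>.  In the comb a block has \<open>2 * s\<close> vertices and
    \<open>s\<^sup>2\<close> edges and its leg has about \<open>t\<close> vertices, so its density is about
    \<open>s\<^sup>2 / ((s + t / 2) * k)\<close>, with \<open>s\<close> just below \<open>k / 2 - t\<close>.  Both exceed the bound for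
    \<open>t\<close> about \<open>0.21 * k\<close>.\<close>
  define k where "k = card (verts T)"
  define t where "t = 21 * k div 100 + 1"
  \<comment> \<open>Taking \<open>0.287 * k\<close> instead of \<open>0.29 * k\<close> leaves room
    for about \<open>2 * t / 99\<close> links and the additive constants.\<close>
  define s where "s = 287 * k div 1000"
  \<comment> \<open>\<open>2 * l\<close> is the least even number above \<open>t\<close>, as the
    comb needs an even leg length.\<close>
  define l where "l = t div 2 + 1"
  have t_bounds: "21 * k \<le> 100 * t" "100 * t \<le> 21 * k + 100"
    and s_bounds: "287 * k \<le> 1000 * s + 1000" "1000 * s \<le> 287 * k"
    and l_bounds: "t < 2 * l" "2 * l \<le> t + 2"
    using div_mult_mod_eq[of "21 * k" 100] div_mult_mod_eq[of "287 * k" 1000] div_mult_mod_eq[of t 2]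
      mod_less_divisor[of 100 "21 * k"] mod_less_divisor[of 1000 "287 * k"] mod_less_divisor[of 2 t]
    by (simp_all add: t_def s_def l_def)
  have k20: "20000 \<le> k" using k by (simp add: k_def)
  have sT: "simple_graph T" using T by (simp add: is_tree_def)
  show ?thesis
  proof (cases "\<exists>C. covers C T \<and> card C \<le> t")
    case False
    \<comment> \<open>For this \<open>n\<close>, subtracting \<open>t\<close> costs at most one
      percent, and \<open>0.21 * 0.99\<close> still exceeds \<open>0.2074\<close>.\<close>
    define n where "n = N + 100 * t"
    have t2: "2 \<le> t" using k20 by (simp add: t_def)
    have "0.2074 * (real k - 2) * real n \<le> real (t * (n - t))"
    proof -
      have "real (21 * k) \<le> real (100 * t)" using t_bounds(1) by (simp only: of_nat_le_iff)
      then have "0.21 * real k \<le> real t" by simp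
      moreover have "0.99 * real n \<le> real n - real t" by (simp add: n_def)
      ultimately have "(0.21 * real k) * (0.99 * real n) \<le> real t * (real n - real t)"
        by (intro mult_mono) auto
      moreover have "0.2074 * (real k - 2) * real n \<le> (0.21 * real k) * (0.99 * real n)"
        by (simp add: algebra_simps)
      moreover have "real t * (real n - real t) = real (t * (n - t))"
        by (simp add: of_nat_diff n_def)
      ultimately show ?thesis by linarith
    qed
    also have "\<dots> \<le> real (card (edges (double_star t n)))"
      using double_star_card_edges by (simp only: of_nat_le_iff)
    finally have "0.2074 * (real k - 2) * real n \<le> real (card (edges (double_star t n)))" .
    moreover have "graph_free T (double_star t n)"
      using False by (intro double_star_free[OF sT]) (meson not_le)
    moreover have "N \<le> n" "0 < n" using t2 by (simp_all add: n_def)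
    ultimately show ?thesis
      using double_star_balanced double_star_connected[OF t2] unfolding k_def[symmetric] by blast
  next
    case True
    then obtain C where C: "covers C T" "card C \<le> t" by blast
    \<comment> \<open>Spine pieces with 99 edges make links rare, yet add only 50 to the
      \<open>n\<close>-share of a unit, a constant independent of \<open>k\<close>. The
      \<open>Suc N\<close> units make \<open>n\<close> as large as required.\<close>
    interpret comb 100 "2 * l" s "Suc N"
      by unfold_locales (use k20 in \<open>auto simp: l_def s_def\<close>)
    define n where "n = Suc N * (P div 2)"
    have P2: "P div 2 = 50 + l + s" by (simp add: P_def)
    have "Suc N * 1 \<le> n" unfolding n_def by (intro mult_le_mono2) (simp add: P2)
    then have n: "N \<le> n" "0 < n" by simp_all
    have "2 * t div 99 * 99 \<le> 2 * t" by (rule div_times_less_eq_dividend)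
    then have "2 * t + 2 * t div 99 + 2 * s + 2 < k"
      using k20 t_bounds s_bounds by linarith
    then have "2 * t + 2 * t div (100 - 1) + 2 * s + 2 < card (verts T)"
      by (simp add: k_def)
    then have free: "graph_free T G" by (rule comb_free[OF T C l_bounds(1)])
    have "0.2074 * (real k - 2) * real n \<le> real (Suc N * s\<^sup>2)"
    proof -
      have "real (287 * k) \<le> real (1000 * s + 1000)" "real (2 * l) \<le> real (t + 2)"
        "real (100 * t) \<le> real (21 * k + 100)"
        using s_bounds t_bounds l_bounds by (simp_all only: of_nat_le_iff)
      then have s: "0.287 * real k - 1 \<le> real s" and l: "real l \<le> 0.105 * real k + 1.5"
        by simp_all
      have "0.2074 * (real k - 2) * (50 + real l + real s) \<le> 0.2074 * real k * (50 + real l + real s)"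
        by (intro mult_right_mono) auto
      also have "\<dots> \<le> 0.2074 * real k * (0.105 * real k + 51.5 + real s)"
        by (rule mult_left_mono) (use l in simp_all)
      \<comment> \<open>Here \<open>0.0796 = 0.287 - 0.2074\<close>, the coefficient left once the
        term with \<open>s\<close> is moved to the other side. The leading coefficients are about
        0.0218 and 0.0228, so \<open>20000 \<le> k\<close> absorbs the linear terms.\<close>
      also have "0.2074 * real k * (0.105 * real k + 51.5) \<le> (0.287 * real k - 1) * (0.0796 * real k - 1)"
      proof -
        have "20000 * real k \<le> real k * real k" by (rule mult_right_mono) (use k20 in simp_all)
        then show ?thesis by (simp add: algebra_simps)
      qed
      then have "0.2074 * real k * (0.105 * real k + 51.5 + real s)
          \<le> (0.287 * real k - 1) * (0.0796 * real k - 1) + 0.2074 * real k * real s"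
        by (simp add: algebra_simps)
      also have "(0.287 * real k - 1) * (0.0796 * real k - 1) \<le> real s * (real s - 0.2074 * real k)"
        using s k20 by (intro mult_mono) auto
      finally have "0.2074 * (real k - 2) * (50 + real l + real s) \<le> (real s)\<^sup>2"
        by (simp add: algebra_simps power2_eq_square)
      then have M: "real (Suc N) * (0.2074 * (real k - 2) * (50 + real l + real s)) \<le> real (Suc N) * (real s)\<^sup>2"
        by (intro mult_left_mono) auto
      have n: "real n = real (Suc N) * (50 + real l + real s)"
        unfolding n_def P2 by (simp add: algebra_simps)
      have "0.2074 * (real k - 2) * real n = real (Suc N) * (0.2074 * (real k - 2) * (50 + real l + real s))"
        unfolding n by (simp only: mult_ac)
      also note M
      also have "real (Suc N) * (real s)\<^sup>2 = real (Suc N * s\<^sup>2)"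
        by (simp only: of_nat_mult of_nat_power)
      finally show ?thesis .
    qed
    also have "\<dots> \<le> real (card (edges G))" using card_edges by (simp only: of_nat_le_iff)
    finally show ?thesis
      using balanced connected free n unfolding k_def[symmetric] n_def by blast
  qed
qed

section \<open>From host graphs to the limits\<close>

lemma limsup_ge_infinitely_often:
  fixes f :: "nat \<Rightarrow> ereal"
  assumes "\<And>N. \<exists>n\<ge>N. c \<le> f n"
  shows "c \<le> limsup f"
  unfolding limsup_INF_SUP
proof (rule INF_greatest)
  fix N
  obtain n where "N \<le> n" "c \<le> f n" using assms by blast
  then show "c \<le> (SUP m\<in>{N..}. f m)" by (intro SUP_upper2[of n]) auto
qed

text \<open>\<open>dense_host\<close> supplies graphs for arbitrarily large \<open>n\<close> rather
  than for all \<open>n\<close>, which is enough for an upper limit.\<close>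

lemma gamma_bc_tree_ge:
  assumes T: "is_tree T" and k: "20000 \<le> card (verts T)"
  shows "ereal 0.2074 \<le> gamma_bc_tree T"
  unfolding gamma_bc_tree_def
proof (rule limsup_ge_infinitely_often)
  fix N
  obtain n and G :: "nat ugraph" where n: "N \<le> n" "0 < n"
    and G: "balanced_bipartite n G" "graph_connected G" "graph_free T G"
    and e: "0.2074 * (real (card (verts T)) - 2) * real n \<le> real (card (edges G))"
    using dense_host[OF T k, of N] by blast
  have "0.2074 * ((real (card (verts T)) - 2) * real n) \<le> real (ex_bc n T)"
    using e ex_bc_ge[OF G] by (simp add: algebra_simps)
  then have "0.2074 \<le> real (ex_bc n T) / ((real (card (verts T)) - 2) * real n)"
    using n k by (subst pos_le_divide_eq) auto
  then show "\<exists>n\<ge>N. ereal 0.2074 \<le> ereal (real (ex_bc n T) / ((real (card (verts T)) - 2) * real n))"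
    using n(1) by auto
qed

text \<open>The constant is half of 0.2074, because \<open>ex_b_le\<close> counts all
  \<open>2 * n\<close> vertices.\<close>

lemma gamma_b_to_bc_tree_ge:
  assumes T: "is_tree T" and k: "20000 \<le> card (verts T)"
  shows "ereal 0.1037 \<le> gamma_b_to_bc_tree T"
  unfolding gamma_b_to_bc_tree_def
proof (rule limsup_ge_infinitely_often)
  fix N
  obtain n and G :: "nat ugraph" where n: "N \<le> n" "0 < n"
    and G: "balanced_bipartite n G" "graph_connected G" "graph_free T G"
    and e: "0.2074 * (real (card (verts T)) - 2) * real n \<le> real (card (edges G))"
    using dense_host[OF T k, of N] by blast
  have 1: "0.2074 * (real (card (verts T)) - 2) * real n \<le> real (ex_bc n T)"
    using e ex_bc_ge[OF G] by linarith
  have "real (ex_b n T) \<le> real ((card (verts T) - 2) * (2 * n))"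
    using ex_b_le[OF T _ G(1,3)] k by (simp del: of_nat_mult)
  also have "\<dots> = (real (card (verts T)) - 2) * (2 * real n)"
    using k by (simp add: of_nat_diff)
  finally have "0.1037 * real (ex_b n T) \<le> real (ex_bc n T)"
    using 1 by (simp add: algebra_simps)
  \<comment> \<open>A quotient with denominator 0 would have the value 0. The host itself shows that
    \<open>ex_b n T\<close> is positive.\<close>
  moreover have "0 < 0.2074 * (real (card (verts T)) - 2) * real n" using n k by simp
  then have "0 < real (ex_b n T)"
    using e ex_b_ge[OF G(1,3)] by linarith
  ultimately have "0.1037 \<le> real (ex_bc n T) / real (ex_b n T)"
    by (subst pos_le_divide_eq)
  then show "\<exists>n\<ge>N. ereal 0.1037 \<le> ereal (real (ex_bc n T) / real (ex_b n T))"
    using n(1) by auto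
qed

text \<open>\<open>lim\<close> is the actual limit only because the infima converge; from index
  \<open>K\<close> on all of them are at least \<open>c\<close>.\<close>

lemma lim_INF_trees_ge:
  fixes f :: "nat ugraph \<Rightarrow> ereal"
  assumes "\<And>T. is_tree T \<Longrightarrow> K \<le> card (verts T) \<Longrightarrow> c \<le> f T"
  shows "c \<le> lim (\<lambda>k. INF T\<in>trees_ge k. f T)"
proof -
  have "(\<lambda>k. INF T\<in>trees_ge k. f T) \<longlonglongrightarrow> lim (\<lambda>k. INF T\<in>trees_ge k. f T)"
    using convergent_INF_trees_ge by (simp add: convergent_LIMSEQ_iff)
  moreover have "\<forall>k\<ge>K. c \<le> (INF T\<in>trees_ge k. f T)"
    using assms by (auto intro!: INF_greatest simp: trees_ge_def)
  ultimately show ?thesis by (blast intro: LIMSEQ_le_const)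
qed

theorem theorem12:
  fixes x\<^sub>0 :: real
  assumes root: "14 * x\<^sub>0\<^sup>2 - 14 * x\<^sub>0 + 3 = 0"
    and larger: "\<And>y :: real. 14 * y\<^sup>2 - 14 * y + 3 = 0 \<Longrightarrow> y \<le> x\<^sub>0"
  shows "0.68898 \<le> x\<^sub>0 \<and> x\<^sub>0 < 0.68899 \<and>
         gamma_bc \<ge> ereal ((2 - 2 * x\<^sub>0) / 3) \<and>
         gamma_bc \<ge> ereal 0.207 \<and>
         gamma_b_to_bc \<ge> ereal 0.1035"
proof -
  \<comment> \<open>The two roots add up to 1, so \<open>1 - x\<^sub>0\<close> is a root as well and
    the larger one is at least one half.\<close>
  have "1 - x\<^sub>0 \<le> x\<^sub>0"
    using root by (intro larger) (simp add: power2_eq_square algebra_simps)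
  then have half: "0 \<le> x\<^sub>0 - 1 / 2" by simp
  have sq: "(x\<^sub>0 - 1 / 2)\<^sup>2 = 1 / 28"
    using root by (simp add: power2_eq_square algebra_simps)
  have "0.18898 \<le> x\<^sub>0 - 1 / 2"
    by (rule power2_le_imp_le[OF _ half], unfold sq) (simp add: power2_eq_square)
  then have lower: "0.68898 \<le> x\<^sub>0" by simp
  have "x\<^sub>0 - 1 / 2 < 0.18899"
    by (rule power2_less_imp_less, unfold sq) (simp_all add: power2_eq_square)
  then have upper: "x\<^sub>0 < 0.68899" by simp
  have bc: "ereal 0.2074 \<le> gamma_bc"
    unfolding gamma_bc_def by (rule lim_INF_trees_ge[OF gamma_bc_tree_ge])
  have b_to_bc: "ereal 0.1037 \<le> gamma_b_to_bc"
    unfolding gamma_b_to_bc_def by (rule lim_INF_trees_ge[OF gamma_b_to_bc_tree_ge])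
  \<comment> \<open>From \<open>0.68898 \<le> x\<^sub>0\<close> the first value is at most 0.20735,
    just below the constant 0.2074.\<close>
  have "ereal ((2 - 2 * x\<^sub>0) / 3) \<le> ereal 0.2074" "ereal 0.207 \<le> ereal 0.2074"
    "ereal 0.1035 \<le> ereal 0.1037"
    using lower by simp_all
  then show ?thesis
    using lower upper bc b_to_bc by (meson order_trans)
qed

end
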